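(* The Krull dimension of $\mathbb{K}\langle z\rangle$ is at least $c$.
   Context: $\mathbb{K}\langle z\rangle$ denotes any one of the following three rings (the statement is meant for each of them): (1) the ring $\mathbb{C}\langle z\rangle$ of complex entire functions of one variable; (2) the ring $\mathbb{C}\langle x\rangle$ of convergent power series $\sum_{n\ge 0}a_nz^n$ in one complex variable $z\in\mathbb{C}$ with real coefficients $a_n\in\mathbb{R}$; (3) the ring $\mathbb{R}\langle x\rangle$ of real analytic functions of one real variable (functions on $\mathbb{R}$ given locally by convergent real power series). $c$ is the cardinality of $\mathbb{R}$. For an infinite cardinal $\kappa$, "the Krull dimension is at least $\kappa$" means that there is a chain (under inclusion) of prime ideals consisting of $\kappa$ many elements. *)

theory Defs
  imports "HOL-Complex_Analysis.Complex_Analysis" "HOL-Algebra.Ideal" "HOL-Library.Equipollence"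
begin

definition function_ring :: "('a \<Rightarrow> 'b::comm_ring_1) set \<Rightarrow> ('a \<Rightarrow> 'b) ring" where
  "function_ring A =
    \<lparr>carrier = A,
     mult = (\<lambda>f g x. f x * g x),
     one = (\<lambda>_. 1),
     zero = (\<lambda>_. 0),
     add = (\<lambda>f g x. f x + g x)\<rparr>"

definition entire_ring :: "(complex \<Rightarrow> complex) ring" where
  "entire_ring = function_ring {f. f holomorphic_on UNIV}"

text \<open>
  The series are required to converge on the whole complex plane; a power series is identified
  with the entire function it represents.
\<close>

definition real_entire_ring :: "(complex \<Rightarrow> complex) ring" where
  "real_entire_ring = function_ring
    {f. \<exists>a :: nat \<Rightarrow> real. \<forall>z. (\<lambda>n. complex_of_real (a n) * z ^ n) sums f z}"

text \<open>
  \<^term>\<open>\<lambda>h. f (x + h)\<close> having an expansion at 0 says that \<^term>\<open>f\<close> agrees, near \<^term>\<open>x\<close>, with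
  a power series in powers of \<^term>\<open>y - x\<close> with positive radius of convergence.
\<close>

definition real_analytic_ring :: "(real \<Rightarrow> real) ring" where
  "real_analytic_ring = function_ring
    {f. \<forall>x. \<exists>F :: real fps. (\<lambda>h. f (x + h)) has_fps_expansion F}"

text \<open>
  An infinite cardinal \<open>\<kappa>\<close> is represented by any set \<^term>\<open>K\<close> of that cardinality.  The definition
  is meant only for infinite \<^term>\<open>K\<close>: it counts the members of the chain, not its inclusion
  steps, so for finite chains it would be off by one from the usual Krull dimension.
\<close>

definition krull_dim_at_least :: "('a, 'm) ring_scheme \<Rightarrow> 'k set \<Rightarrow> bool" where
  "krull_dim_at_least R K \<longleftrightarrow> (\<exists>C. subset.chain {P. primeideal P R} C \<and> C \<approx> K)"

end

theory Submission
  imports Defs "HOL-Real_Asymp.Real_Asymp"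
begin

text \<open>
  In each of the three rings a function can be given any sequence of positive vanishing orders at
  the points $1, 2, 3, \ldots$, by a Weierstrass product. Primes are told apart by how fast these
  orders grow. Fix a nonprincipal ultrafilter \<open>U\<close> on the naturals and a rate \<open>\<phi>\<close>, and let \<open>P\<^sub>\<phi>\<close>
  consist of the functions whose orders are, along \<open>U\<close>, eventually above every multiple of \<open>\<phi>\<close>.
  It is an ideal because orders behave as valuations. It is prime: if \<open>f\<close> stays below \<open>k\<phi>\<close> and
  \<open>g\<close> below \<open>l\<phi>\<close> along \<open>U\<close>, then \<open>f g\<close> stays below \<open>(k + l)\<phi>\<close>; the ultrafilter is what turns
  ``not eventually above'' into ``eventually below''.

  If \<open>\<phi> = o(\<psi>)\<close> then \<open>P\<^sub>\<psi>\<close> is strictly smaller than \<open>P\<^sub>\<phi>\<close>: a function whose orders are exactly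
  \<open>\<psi>\<close> lies in the second ideal but not in the first. The powers $(n+1)^{\alpha}$ with
  $\alpha > 0$ are a family of rates of size continuum that is linearly ordered by \<open>o\<close>, so their
  ideals form the required chain. The argument needs only a sequence of valuations that can be
  prescribed freely (\<open>krull_dim_at_least_continuum\<close>).

  One entire function serves all three rings: since the zeros are real, the product commutes with
  complex conjugation, hence has real Taylor coefficients at every real point
  (\<open>prescribed_vanishing_orders\<close>). So it belongs to the ring of real power series, and its
  restriction to the real line is real analytic with the same orders.
\<close>

section \<open>Nonprincipal ultrafilters\<close>

text \<open>
  A minimal element, by Zorn's lemma, among the proper filters finer than the filter
  \<^term>\<open>sequentially\<close>: if such a filter did not decide \<open>P\<close>, it could be refined by adding \<open>P\<close>.
\<close>

lemma nonprincipal_ultrafilter_exists: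
  obtains U :: "nat filter"
  where "U \<noteq> bot" "U \<le> sequentially"
    "\<And>P. eventually P U \<or> eventually (\<lambda>n. \<not> P n) U"
proof -
  define X where "X = {F :: nat filter. F \<noteq> bot \<and> F \<le> sequentially}"
  have "\<exists>m\<in>X. \<forall>a\<in>X. a \<le> m \<longrightarrow> a = m"
  proof (rule predicate_Zorn[where P = "\<lambda>F G. G \<le> F"])
    show "partial_order_on X (relation_of (\<lambda>F G. G \<le> F) X)"
      by (rule partial_order_on_relation_ofI) auto
  next
    fix C assume "C \<in> Chains (relation_of (\<lambda>F G. G \<le> F) X)"
    then have C: "C \<subseteq> X" "\<And>F G. F \<in> C \<Longrightarrow> G \<in> C \<Longrightarrow> F \<le> G \<or> G \<le> F"
      by (auto simp: Chains_def relation_of_def)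
    show "\<exists>u\<in>X. \<forall>a\<in>C. u \<le> a"
    proof (cases "C = {}")
      case True
      then show ?thesis by (auto simp: X_def intro!: exI[of _ sequentially])
    next
      case False
      \<comment> \<open>What holds eventually for the infimum of a chain holds eventually for a member.\<close>
      have "eventually (\<lambda>_. False) (Inf C) \<longleftrightarrow> (\<exists>F\<in>C. eventually (\<lambda>_. False) F)"
        by (rule eventually_Inf_base[OF False]) (metis C(2) inf.absorb1 inf.absorb2 order_refl)
      with C(1) have "Inf C \<noteq> bot"
        by (auto simp: X_def trivial_limit_def)
      moreover have "Inf C \<le> sequentially"
        using False C(1) by (auto simp: X_def intro: Inf_lower2)
      ultimately show ?thesis
        by (auto simp: X_def intro!: bexI[of _ "Inf C"] Inf_lower)
    qed
  qed
  then obtain U where U: "U \<noteq> bot" "U \<le> sequentially"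
    and max: "\<And>F. F \<noteq> bot \<Longrightarrow> F \<le> U \<Longrightarrow> F = U"
    by (auto simp: X_def)
  show thesis
  proof (rule that[OF U])
    fix P
    show "eventually P U \<or> eventually (\<lambda>n. \<not> P n) U"
    proof (rule disjCI)
      assume "\<not> eventually (\<lambda>n. \<not> P n) U"
      then have "inf U (principal {n. P n}) \<noteq> bot"
        by (simp add: trivial_limit_def eventually_inf_principal)
      then have "inf U (principal {n. P n}) = U"
        by (rule max) simp
      moreover have "eventually P (inf U (principal {n. P n}))"
        by (simp add: eventually_inf_principal)
      ultimately show "eventually P U" by simp
    qed
  qed
qed

section \<open>Prime ideals from growth rates\<close>

text \<open>
  The quantification over all multiples \<open>k\<close> is what makes the ideal prime: a bound by \<open>\<phi>\<close> alone
  is shared out between the factors of a product.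
\<close>

definition growth_ideal ::
    "('a, 'm) ring_scheme \<Rightarrow> (nat \<Rightarrow> 'a \<Rightarrow> enat) \<Rightarrow> nat filter \<Rightarrow> (nat \<Rightarrow> nat) \<Rightarrow> 'a set" where
  "growth_ideal R v U \<phi> = {f \<in> carrier R. \<forall>k. eventually (\<lambda>n. enat (k * \<phi> n) \<le> v n f) U}"

locale valuation_sequence = cring R for R (structure) +
  fixes v :: "nat \<Rightarrow> 'a \<Rightarrow> enat"
  assumes v_mult: "\<lbrakk>f \<in> carrier R; g \<in> carrier R\<rbrakk> \<Longrightarrow> v n (f \<otimes> g) = v n f + v n g"
    and v_add: "\<lbrakk>f \<in> carrier R; g \<in> carrier R\<rbrakk> \<Longrightarrow> min (v n f) (v n g) \<le> v n (f \<oplus> g)"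
    and v_zero: "v n \<zero> = \<infinity>"
    and v_one: "v n \<one> = 0"
begin

text \<open>
  Sums stay in the ideal by the ultrametric inequality, multiples because valuations are
  nonnegative. For primality, a factor outside the ideal is below some multiple of \<open>\<phi>\<close> along the
  ultrafilter; adding the two bounds contradicts the growth of the product.
\<close>

lemma primeideal_growth_ideal:
  assumes proper: "U \<noteq> bot"
    and ultra: "\<And>P. eventually P U \<or> eventually (\<lambda>n. \<not> P n) U"
    and pos: "\<And>n. \<phi> n > 0"
  shows "primeideal (growth_ideal R v U \<phi>) R"
proof -
  let ?P = "growth_ideal R v U \<phi>"
  have mult: "x \<otimes> a \<in> ?P" if a: "a \<in> ?P" and x: "x \<in> carrier R" for a x
  proof -
    have "eventually (\<lambda>n. enat (k * \<phi> n) \<le> v n (x \<otimes> a)) U" for k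
    proof -
      have "eventually (\<lambda>n. enat (k * \<phi> n) \<le> v n a) U"
        using a by (simp add: growth_ideal_def)
      then show ?thesis
        by (rule eventually_mono) (use a x in \<open>simp add: growth_ideal_def v_mult add_increasing\<close>)
    qed
    then show ?thesis
      using a x by (simp add: growth_ideal_def)
  qed
  have sub: "additive_subgroup ?P R"
  proof (intro additive_subgroupI add.subgroupI)
    show "?P \<subseteq> carrier R"
      by (auto simp: growth_ideal_def)
    have "\<zero> \<in> ?P"
      by (auto simp: growth_ideal_def v_zero)
    then show "?P \<noteq> {}" by auto
    fix a assume a: "a \<in> ?P"
    then have "a \<in> carrier R" by (auto simp: growth_ideal_def)
    \<comment> \<open>Closure under negatives is a case of closure under multiples.\<close>
    then have "\<ominus> a = (\<ominus> \<one>) \<otimes> a"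
      by (simp add: l_minus)
    then show "\<ominus> a \<in> ?P"
      using mult[OF a, of "\<ominus> \<one>"] by simp
    fix b assume b: "b \<in> ?P"
    have "eventually (\<lambda>n. enat (k * \<phi> n) \<le> v n (a \<oplus> b)) U" for k
    proof -
      have "eventually (\<lambda>n. enat (k * \<phi> n) \<le> v n a) U" "eventually (\<lambda>n. enat (k * \<phi> n) \<le> v n b) U"
        using a b by (auto simp: growth_ideal_def)
      then show ?thesis
      proof eventually_elim
        case (elim n)
        then show ?case
          using v_add[of a b n] a b by (auto simp: growth_ideal_def intro: order.trans[rotated])
      qed
    qed
    then show "a \<oplus> b \<in> ?P"
      using a b by (auto simp: growth_ideal_def)
  qed
  show ?thesis
  proof (rule primeidealI2[OF sub is_cring])
    show "x \<otimes> a \<in> ?P" "a \<otimes> x \<in> ?P" if "a \<in> ?P" "x \<in> carrier R" for a x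
      using mult[OF that] that by (simp_all add: m_comm growth_ideal_def)
    have "\<not> eventually (\<lambda>n. enat (1 * \<phi> n) \<le> v n \<one>) U"
      using pos proper by (simp add: v_one zero_enat_def less_imp_neq[symmetric])
    then have "\<one> \<notin> ?P"
      unfolding growth_ideal_def by blast
    then show "carrier R \<noteq> ?P" by auto
  next
    fix a b assume ab: "a \<in> carrier R" "b \<in> carrier R" "a \<otimes> b \<in> ?P"
    show "a \<in> ?P \<or> b \<in> ?P"
    proof (rule ccontr)
      assume "\<not> ?thesis"
      then obtain k l where "\<not> eventually (\<lambda>n. enat (k * \<phi> n) \<le> v n a) U"
        "\<not> eventually (\<lambda>n. enat (l * \<phi> n) \<le> v n b) U"
        using ab by (auto simp: growth_ideal_def)
      then have "eventually (\<lambda>n. v n a < enat (k * \<phi> n)) U" "eventually (\<lambda>n. v n b < enat (l * \<phi> n)) U"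
        using ultra[of "\<lambda>n. enat (k * \<phi> n) \<le> v n a"] ultra[of "\<lambda>n. enat (l * \<phi> n) \<le> v n b"]
        by (simp_all add: not_le)
      moreover have "eventually (\<lambda>n. enat ((k + l) * \<phi> n) \<le> v n (a \<otimes> b)) U"
        using ab(3) unfolding growth_ideal_def by blast
      ultimately have "eventually (\<lambda>n. False) U"
      proof eventually_elim
        case (elim n)
        have "v n a + v n b < enat (k * \<phi> n) + enat (l * \<phi> n)"
          using elim(1,2) by (cases "v n a"; cases "v n b") auto
        with elim(3) show ?case
          by (simp add: v_mult ab algebra_simps)
      qed
      then show False using proper by simp
    qed
  qed
qed

text \<open>
  The element \<open>f\<close> witnesses strictness: its valuations \<open>\<psi>\<close> are eventually above every multiple of \<open>\<phi>\<close>,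
  but always below \<open>2\<psi>\<close>.
\<close>

lemma growth_ideal_strict_antimono:
  assumes proper: "U \<noteq> bot" and U: "U \<le> sequentially"
    and pos: "\<And>n. \<psi> n > 0"
    and faster: "\<And>k. eventually (\<lambda>n. k * \<phi> n \<le> \<psi> n) sequentially"
    and f: "f \<in> carrier R" "\<And>n. v n f = enat (\<psi> n)"
  shows "growth_ideal R v U \<psi> \<subset> growth_ideal R v U \<phi>"
proof
  have faster': "eventually (\<lambda>n. k * \<phi> n \<le> \<psi> n) U" for k
    using filter_leD[OF U] faster by blast
  show "growth_ideal R v U \<psi> \<subseteq> growth_ideal R v U \<phi>"
  proof
    fix g assume g: "g \<in> growth_ideal R v U \<psi>"
    then have "eventually (\<lambda>n. enat (1 * \<psi> n) \<le> v n g) U"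
      unfolding growth_ideal_def by blast
    then have "eventually (\<lambda>n. enat (k * \<phi> n) \<le> v n g) U" for k
      using faster'[of k] by eventually_elim (auto intro: order.trans[rotated])
    with g show "g \<in> growth_ideal R v U \<phi>"
      by (auto simp: growth_ideal_def)
  qed
  have "f \<in> growth_ideal R v U \<phi>"
    using f faster' by (auto simp: growth_ideal_def)
  moreover have "\<not> eventually (\<lambda>n. enat (2 * \<psi> n) \<le> v n f) U"
    using pos proper by (simp add: f(2) not_le)
  then have "f \<notin> growth_ideal R v U \<psi>"
    unfolding growth_ideal_def by blast
  ultimately show "growth_ideal R v U \<psi> \<noteq> growth_ideal R v U \<phi>"
    by blast
qed

end

text \<open>
  The exponent is \<^term>\<open>exp t\<close> so that all of \<open>\<real>\<close> parametrizes the positive exponents.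
\<close>

definition growth_rate :: "real \<Rightarrow> nat \<Rightarrow> nat" where
  "growth_rate t n = nat \<lceil>real (Suc n) powr exp t\<rceil>"

lemma growth_rate_pos: "growth_rate t n > 0"
  by (simp add: growth_rate_def)

lemma growth_rate_faster:
  assumes "s < t"
  shows "eventually (\<lambda>n. k * growth_rate s n \<le> growth_rate t n) sequentially"
proof -
  \<comment> \<open>The rates differ from the powers by at most 1, and \<open>K > 0\<close> also when \<open>k = 0\<close>.\<close>
  define a b K where "a = exp s" "b = exp t" "K = real k + 1"
  have ab: "0 < a" "a < b" "K > 0"
    using assms by (auto simp: a_b_K_def)
  have "eventually (\<lambda>n. K * (real (Suc n) powr a + 1) \<le> real (Suc n) powr b) sequentially"
    using ab by real_asymp
  then show ?thesis
  proof eventually_elim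
    case (elim n)
    have s: "real (growth_rate s n) \<le> real (Suc n) powr a + 1"
      unfolding growth_rate_def a_b_K_def by (simp add: of_nat_nat)
    have "real (k * growth_rate s n) \<le> K * (real (Suc n) powr a + 1)"
      unfolding of_nat_mult using s by (intro mult_mono) (auto simp: a_b_K_def)
    also have "\<dots> \<le> real (Suc n) powr b"
      by (fact elim)
    also have "\<dots> \<le> real (growth_rate t n)"
      unfolding growth_rate_def a_b_K_def by linarith
    finally show ?case by linarith
  qed
qed

lemma (in valuation_sequence) krull_dim_at_least_continuum:
  assumes interpolation: "\<And>m :: nat \<Rightarrow> nat. (\<And>n. m n > 0) \<Longrightarrow>
    \<exists>f\<in>carrier R. \<forall>n. v n f = enat (m n)"
  shows "krull_dim_at_least R (UNIV :: real set)"
proof -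
  obtain U :: "nat filter" where U: "U \<noteq> bot" "U \<le> sequentially"
    "\<And>P. eventually P U \<or> eventually (\<lambda>n. \<not> P n) U"
    using nonprincipal_ultrafilter_exists by blast
  define P where "P t = growth_ideal R v U (growth_rate t)" for t
  have strict: "P t \<subset> P s" if st: "s < t" for s t
  proof -
    obtain f where "f \<in> carrier R" "\<And>n. v n f = enat (growth_rate t n)"
      using interpolation[of "growth_rate t"] growth_rate_pos by blast
    then show ?thesis
      unfolding P_def
      by (intro growth_ideal_strict_antimono U(1,2) growth_rate_pos growth_rate_faster st)
  qed
  have "inj P"
    by (rule linorder_injI) (use strict in blast)
  then have "range P \<approx> (UNIV :: real set)"
    by (simp add: inj_on_image_eqpoll_self)
  moreover have "subset.chain {I. primeideal I R} (range P)"
    unfolding subset_chain_def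
  proof (intro conjI ballI)
    show "range P \<subseteq> {I. primeideal I R}"
      unfolding P_def using U growth_rate_pos by (auto intro: primeideal_growth_ideal)
    show "I \<subseteq> J \<or> J \<subseteq> I" if IJ: "I \<in> range P" "J \<in> range P" for I J
    proof -
      obtain s t where "I = P s" "J = P t" using IJ by auto
      then show ?thesis
        using strict[of s t] strict[of t s] by (cases s t rule: linorder_cases) auto
    qed
  qed
  ultimately show ?thesis
    unfolding krull_dim_at_least_def by blast
qed

section \<open>Rings of functions and vanishing orders\<close>

lemma cring_function_ring:
  assumes zero: "(\<lambda>_. 0) \<in> A" and one: "(\<lambda>_. 1) \<in> A"
    and add: "\<And>f g. f \<in> A \<Longrightarrow> g \<in> A \<Longrightarrow> (\<lambda>x. f x + g x) \<in> A"
    and mult: "\<And>f g. f \<in> A \<Longrightarrow> g \<in> A \<Longrightarrow> (\<lambda>x. f x * g x) \<in> A"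
    and minus: "\<And>f. f \<in> A \<Longrightarrow> (\<lambda>x. - f x) \<in> A"
  shows "cring (function_ring A)"
proof (rule cringI)
  show "abelian_group (function_ring A)"
  proof (rule abelian_groupI)
    fix f assume "f \<in> carrier (function_ring A)"
    then show "\<exists>g\<in>carrier (function_ring A). g \<oplus>\<^bsub>function_ring A\<^esub> f = \<zero>\<^bsub>function_ring A\<^esub>"
      by (intro bexI[of _ "\<lambda>x. - f x"]) (auto simp: function_ring_def minus)
  qed (use zero add in \<open>auto simp: function_ring_def algebra_simps\<close>)
  show "comm_monoid (function_ring A)"
    by (rule comm_monoidI) (use one mult in \<open>auto simp: function_ring_def algebra_simps\<close>)
qed (auto simp: function_ring_def algebra_simps)

text \<open>
  Uniqueness of Taylor expansions over the reals and the complex numbers alike. Dividing the zero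
  function by \<open>x ^ subdegree F\<close> must yield a function continuous at 0, whose value there is the
  leading coefficient of \<open>F\<close>.
\<close>

lemma has_fps_expansion_zero_unique:
  fixes F :: "'a :: {banach, real_normed_field} fps"
  assumes "(\<lambda>_. 0) has_fps_expansion F"
  shows "F = 0"
proof (rule ccontr)
  assume "F \<noteq> 0"
  define c where "c = fps_nth F (subdegree F)"
  have "(\<lambda>x. if x = 0 then c else 0 / x ^ subdegree F) has_fps_expansion fps_shift (subdegree F) F"
    by (rule has_fps_expansion_shift[OF assms]) (auto simp: c_def)
  then have "isCont (\<lambda>x :: 'a. if x = 0 then c else 0 / x ^ subdegree F) 0"
    by (rule has_fps_expansion_imp_continuous)
  then have "((\<lambda>x :: 'a. if x = 0 then c else 0 / x ^ subdegree F) \<longlongrightarrow> c) (at 0)"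
    by (simp add: isCont_def)
  moreover have "((\<lambda>x :: 'a. if x = 0 then c else 0 / x ^ subdegree F) \<longlongrightarrow> 0) (at 0)"
    by (rule tendsto_eventually) (simp add: eventually_at_filter)
  ultimately have "c = 0"
    using tendsto_unique[OF at_neq_bot] by blast
  with \<open>F \<noteq> 0\<close> show False by (simp add: c_def)
qed

lemma has_fps_expansion_unique:
  fixes F G :: "'a :: {banach, real_normed_field} fps"
  assumes "f has_fps_expansion F" "f has_fps_expansion G"
  shows "F = G"
  using has_fps_expansion_zero_unique[of "F - G"] has_fps_expansion_diff[OF assms] by simp

text \<open>
  \<^const>\<open>subdegree\<close> sends the zero series to 0; as a valuation it has to be infinite there.
\<close>

definition fps_order :: "'a :: zero fps \<Rightarrow> enat" where
  "fps_order F = (if F = 0 then \<infinity> else enat (subdegree F))"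

definition vanishing_order :: "('a :: {banach, real_normed_field} \<Rightarrow> 'a) \<Rightarrow> 'a \<Rightarrow> enat" where
  "vanishing_order f a = fps_order (THE F. (\<lambda>h. f (a + h)) has_fps_expansion F)"

lemma vanishing_order_eq:
  "(\<lambda>h. f (a + h)) has_fps_expansion F \<Longrightarrow> vanishing_order f a = fps_order F"
  unfolding vanishing_order_def by (metis has_fps_expansion_unique the_equality)

lemma fps_order_mult:
  "fps_order (F * G :: 'a :: semiring_no_zero_divisors fps) = fps_order F + fps_order G"
  by (auto simp: fps_order_def)

lemma fps_order_add:
  "min (fps_order F) (fps_order G) \<le> fps_order (F + G :: 'a :: monoid_add fps)"
  using subdegree_add_ge'[of F G] by (auto simp: fps_order_def min_def split: if_splits)

text \<open>
  Passing to the Taylor series at a point is a ring homomorphism, so the vanishing orders at the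
  points \<open>a n\<close> are valuations, to which \<open>krull_dim_at_least_continuum\<close> applies.
\<close>

lemma krull_dim_function_ring:
  fixes A :: "('a :: {banach, real_normed_field} \<Rightarrow> 'a) set" and a :: "nat \<Rightarrow> 'a"
  assumes cring: "cring (function_ring A)"
    and expansion: "\<And>f n. f \<in> A \<Longrightarrow> \<exists>F. (\<lambda>h. f (a n + h)) has_fps_expansion F"
    and interpolation: "\<And>m :: nat \<Rightarrow> nat. (\<And>n. m n > 0) \<Longrightarrow>
      \<exists>f\<in>A. \<forall>n. \<exists>F. (\<lambda>h. f (a n + h)) has_fps_expansion F \<and> F \<noteq> 0 \<and> subdegree F = m n"
  shows "krull_dim_at_least (function_ring A) (UNIV :: real set)"
proof -
  let ?R = "function_ring A"
  have carrier: "carrier ?R = A"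
    by (simp add: function_ring_def)
  interpret valuation_sequence ?R "\<lambda>n f. vanishing_order f (a n)"
  proof (intro valuation_sequence.intro valuation_sequence_axioms.intro cring)
    fix f g n assume fg: "f \<in> carrier ?R" "g \<in> carrier ?R"
    obtain F where F: "(\<lambda>h. f (a n + h)) has_fps_expansion F"
      using expansion fg carrier by blast
    obtain G where G: "(\<lambda>h. g (a n + h)) has_fps_expansion G"
      using expansion fg carrier by blast
    show "vanishing_order (f \<otimes>\<^bsub>?R\<^esub> g) (a n) = vanishing_order f (a n) + vanishing_order g (a n)"
      using vanishing_order_eq[OF F] vanishing_order_eq[OF G]
        vanishing_order_eq[of "f \<otimes>\<^bsub>?R\<^esub> g" "a n" "F * G"] has_fps_expansion_mult[OF F G]
      by (simp add: function_ring_def fps_order_mult)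
    show "min (vanishing_order f (a n)) (vanishing_order g (a n))
        \<le> vanishing_order (f \<oplus>\<^bsub>?R\<^esub> g) (a n)"
      using vanishing_order_eq[OF F] vanishing_order_eq[OF G]
        vanishing_order_eq[of "f \<oplus>\<^bsub>?R\<^esub> g" "a n" "F + G"] has_fps_expansion_add[OF F G]
      by (simp add: function_ring_def fps_order_add)
  next
    fix n
    show "vanishing_order \<zero>\<^bsub>?R\<^esub> (a n) = \<infinity>"
      using vanishing_order_eq[of "\<lambda>_. 0" "a n" 0] by (simp add: function_ring_def fps_order_def)
    show "vanishing_order \<one>\<^bsub>?R\<^esub> (a n) = 0"
      using vanishing_order_eq[of "\<lambda>_. 1" "a n" 1]
      by (simp add: function_ring_def fps_order_def zero_enat_def)
  qed
  show ?thesis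
  proof (rule krull_dim_at_least_continuum)
    fix m :: "nat \<Rightarrow> nat" assume "\<And>n. m n > 0"
    then obtain f where "f \<in> A" "\<And>n. \<exists>F. (\<lambda>h. f (a n + h)) has_fps_expansion F \<and> F \<noteq> 0 \<and> subdegree F = m n"
      using interpolation by meson
    then show "\<exists>f\<in>carrier ?R. \<forall>n. vanishing_order f (a n) = enat (m n)"
      unfolding carrier
      by (metis fps_order_def vanishing_order_eq)
  qed
qed

section \<open>Real entire functions with prescribed zeros\<close>

text \<open>
  If \<open>c\<close> are the Taylor coefficients of \<open>g\<close> at \<open>x\<close>, then by symmetry their conjugates also sum to
  \<open>g\<close>. Averaging the two series gives one with the real coefficients \<open>Re (c k)\<close>.
\<close>

lemma real_taylor_expansion:
  assumes hol: "g holomorphic_on UNIV" and sym: "\<And>z. g (cnj z) = cnj (g z)"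
  shows "\<exists>F :: real fps. \<forall>z.
    (\<lambda>k. complex_of_real (fps_nth F k) * z ^ k) sums g (complex_of_real x + z)"
proof -
  define f where "f = (\<lambda>z. g (complex_of_real x + z))"
  have f: "f holomorphic_on UNIV"
    unfolding f_def
    by (rule holomorphic_on_compose_gen[OF _ hol, unfolded o_def]) (auto intro!: holomorphic_intros)
  obtain c where c: "\<And>z. (\<lambda>k. c k * z ^ k) sums f z"
  proof
    fix z
    have "(\<lambda>k. (deriv ^^ k) f 0 / fact k * (z - 0) ^ k) sums f z"
      by (rule holomorphic_power_series[of f 0 "norm z + 1"])
        (auto intro: holomorphic_on_subset[OF f])
    then show "(\<lambda>k. (deriv ^^ k) f 0 / fact k * z ^ k) sums f z" by simp
  qed
  show ?thesis
  proof (intro exI[of _ "Abs_fps (\<lambda>k. Re (c k))"] allI)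
    fix z
    have "(\<lambda>k. cnj (c k * cnj z ^ k)) sums cnj (f (cnj z))"
      using c[of "cnj z"] by (subst sums_cnj)
    moreover have "cnj (f (cnj z)) = f z"
      using sym[of "complex_of_real x + z"] by (simp add: f_def)
    ultimately have "(\<lambda>k. cnj (c k) * z ^ k) sums f z"
      by simp
    with c have "(\<lambda>k. (c k * z ^ k + cnj (c k) * z ^ k) / 2) sums ((f z + f z) / 2)"
      by (intro sums_divide sums_add)
    also have "(\<lambda>k. (c k * z ^ k + cnj (c k) * z ^ k) / 2) = (\<lambda>k. of_real (Re (c k)) * z ^ k)"
      by (simp add: distrib_right[symmetric] complex_add_cnj)
    finally show "(\<lambda>k. of_real (fps_nth (Abs_fps (\<lambda>k. Re (c k))) k) * z ^ k) sums g (of_real x + z)"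
      by (simp add: f_def)
  qed
qed

text \<open>
  The symmetric description is closed under products at a glance, which spares the Cauchy product
  of series in the proof that the real power series form a ring.
\<close>

lemma real_power_series_iff_symmetric:
  "(\<exists>a :: nat \<Rightarrow> real. \<forall>z. (\<lambda>n. complex_of_real (a n) * z ^ n) sums f z) \<longleftrightarrow>
    f holomorphic_on UNIV \<and> (\<forall>z. f (cnj z) = cnj (f z))"
proof
  assume "\<exists>a :: nat \<Rightarrow> real. \<forall>z. (\<lambda>n. complex_of_real (a n) * z ^ n) sums f z"
  then obtain a :: "nat \<Rightarrow> real" where a: "\<And>z. (\<lambda>n. complex_of_real (a n) * z ^ n) sums f z"
    by blast
  have hol: "f holomorphic_on ball 0 r" for r
    by (rule power_series_holomorphic[where a = "\<lambda>n. complex_of_real (a n)"]) (simp add: a)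
  have "f field_differentiable at z" for z
    by (rule holomorphic_on_imp_differentiable_at[OF hol[of "norm z + 1"] open_ball]) simp
  moreover have "f (cnj z) = cnj (f z)" for z
    using sums_unique2[OF a[of "cnj z"]] sums_cnj[THEN iffD2, OF a[of z]] by simp
  ultimately show "f holomorphic_on UNIV \<and> (\<forall>z. f (cnj z) = cnj (f z))"
    by (auto simp: holomorphic_on_def intro: field_differentiable_at_within)
next
  assume "f holomorphic_on UNIV \<and> (\<forall>z. f (cnj z) = cnj (f z))"
  then obtain F :: "real fps"
    where "\<And>z. (\<lambda>k. complex_of_real (fps_nth F k) * z ^ k) sums f (complex_of_real 0 + z)"
    using real_taylor_expansion[of f 0] by blast
  then show "\<exists>a :: nat \<Rightarrow> real. \<forall>z. (\<lambda>n. complex_of_real (a n) * z ^ n) sums f z"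
    by auto
qed

definition fps_of_real :: "real fps \<Rightarrow> complex fps" where
  "fps_of_real F = Abs_fps (\<lambda>k. complex_of_real (fps_nth F k))"

lemma fps_of_real_eq_0_iff [simp]: "fps_of_real F = 0 \<longleftrightarrow> F = 0"
  by (simp add: fps_of_real_def fps_eq_iff)

lemma subdegree_fps_of_real [simp]: "subdegree (fps_of_real F) = subdegree F"
proof (cases "F = 0")
  case True
  then show ?thesis by (metis fps_of_real_eq_0_iff subdegree_0)
next
  case False
  then show ?thesis by (auto simp: fps_of_real_def intro!: subdegreeI)
qed

lemma has_fps_expansion_fps_of_real:
  assumes "\<And>z. (\<lambda>k. complex_of_real (fps_nth F k) * z ^ k) sums g (a + z)"
  shows "(\<lambda>h. g (a + h)) has_fps_expansion fps_of_real F"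
  by (rule has_fps_expansionI) (simp add: fps_of_real_def assms)

lemma has_fps_expansion_real_restriction:
  assumes "\<And>z. (\<lambda>k. complex_of_real (fps_nth F k) * z ^ k) sums g (complex_of_real x + z)"
  shows "(\<lambda>h. Re (g (complex_of_real (x + h)))) has_fps_expansion F"
proof (rule has_fps_expansionI, rule always_eventually, rule allI)
  fix h
  show "(\<lambda>k. fps_nth F k * h ^ k) sums Re (g (complex_of_real (x + h)))"
    using sums_Re[OF assms[of "complex_of_real h"]]
    by (simp flip: of_real_power of_real_mult)
qed

text \<open>
  Weierstrass product over the sequence \<open>b\<close> that runs through the positive integers and repeats
  \<open>n + 1\<close> exactly \<open>m n\<close> times. The zeros avoid the origin because the factors are functions
  of \<open>z / b n\<close>. Every factor commutes with conjugation because its zero is real.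
\<close>

lemma symmetric_entire_with_prescribed_zeros:
  fixes m :: "nat \<Rightarrow> nat"
  assumes m: "\<And>n. m n > 0"
  obtains g where "g holomorphic_on UNIV" "\<And>z. g (cnj z) = cnj (g z)" "g 0 \<noteq> 0"
    "\<And>n. zorder g (of_nat (Suc n)) = int (m n)"
proof -
  define A :: "complex set" where "A = of_nat ` {1..}"
  \<comment> \<open>Multiplicity as a function of the point: the zero \<open>n + 1\<close> carries \<open>m n\<close>.\<close>
  define c where "c z = m (nat \<lfloor>Re z\<rfloor> - 1)" for z
  have "infinite A"
    unfolding A_def by (simp add: finite_image_iff inj_on_def infinite_Ici)
  moreover have "closed A"
    unfolding A_def by (rule closed_of_nat_image)
  moreover have "finite (A \<inter> cball 0 r)" if "r \<ge> 0" for r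
  proof (rule finite_subset)
    show "A \<inter> cball 0 r \<subseteq> of_nat ` {..nat \<lfloor>r\<rfloor>}"
      by (auto simp: A_def le_nat_floor)
  qed simp
  moreover have "c z > 0" for z
    by (simp add: c_def m)
  ultimately obtain b :: "nat \<Rightarrow> complex" where b: "range b = A" "filterlim b at_infinity at_top"
    "\<And>z. z \<in> A \<Longrightarrow> finite (b -` {z}) \<and> card (b -` {z}) = c z"
    using sequence_of_sparse_set_exists'[of A c] by metis
  interpret W: weierstrass_product' b
  proof
    show "b n \<noteq> 0" for n
    proof -
      have "b n \<in> A" using b(1) by blast
      then show ?thesis by (auto simp: A_def)
    qed
  qed (use b in auto)
  have real: "cnj (b n) = b n" for n
  proof -
    have "b n \<in> A" using b(1) by blast
    then show ?thesis by (auto simp: A_def)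
  qed
  have factor: "weierstrass_factor n (cnj z) = cnj (weierstrass_factor n z)" for n z
    by (simp add: weierstrass_factor_def exp_cnj)
  show thesis
  proof
    show "W.f holomorphic_on UNIV"
      by (rule W.holomorphic)
    show "W.f 0 \<noteq> 0"
      using W.zero[of 0] b(1) by (auto simp: A_def)
    show "W.f (cnj z) = cnj (W.f z)" for z
    proof (rule LIMSEQ_unique)
      show "(\<lambda>N. \<Prod>n\<le>N. weierstrass_factor n (cnj z / b n)) \<longlonglongrightarrow> W.f (cnj z)"
        unfolding W.f_def by (rule convergent_prod_LIMSEQ[OF W.convergent])
      have "(\<lambda>N. cnj (\<Prod>n\<le>N. weierstrass_factor n (z / b n))) \<longlonglongrightarrow> cnj (W.f z)"
        unfolding W.f_def by (intro tendsto_cnj convergent_prod_LIMSEQ[OF W.convergent])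
      then show "(\<lambda>N. \<Prod>n\<le>N. weierstrass_factor n (cnj z / b n)) \<longlonglongrightarrow> cnj (W.f z)"
        by (simp add: factor[symmetric] real)
    qed
    fix n
    have "of_nat (Suc n) \<in> A" unfolding A_def by (intro imageI) simp
    then show "zorder W.f (of_nat (Suc n)) = int (m n)"
      using b(3) by (simp add: W.zorder c_def nat_add_distrib)
  qed
qed

text \<open>
  The function of the previous lemma together with its real Taylor series at the positive
  integers, in the form used for both complex and real arguments.
\<close>

lemma prescribed_vanishing_orders:
  fixes m :: "nat \<Rightarrow> nat"
  assumes "\<And>n. m n > 0"
  shows "\<exists>g (F :: nat \<Rightarrow> real fps). g holomorphic_on UNIV \<and> (\<forall>z. g (cnj z) = cnj (g z)) \<and>
    (\<forall>n. F n \<noteq> 0) \<and> (\<forall>n. subdegree (F n) = m n) \<and>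
    (\<forall>n z. (\<lambda>k. complex_of_real (fps_nth (F n) k) * z ^ k) sums g (of_nat (Suc n) + z))"
proof -
  obtain g where g: "g holomorphic_on UNIV" "\<And>z. g (cnj z) = cnj (g z)" "g 0 \<noteq> 0"
    "\<And>n. zorder g (of_nat (Suc n)) = int (m n)"
    using symmetric_entire_with_prescribed_zeros assms by metis
  have "\<exists>F :: real fps. \<forall>z. (\<lambda>k. complex_of_real (fps_nth F k) * z ^ k) sums g (of_nat (Suc n) + z)" for n
    using real_taylor_expansion[OF g(1,2), of "real (Suc n)"] by (metis of_real_of_nat_eq)
  then obtain F :: "nat \<Rightarrow> real fps"
    where F: "\<And>n z. (\<lambda>k. complex_of_real (fps_nth (F n) k) * z ^ k) sums g (of_nat (Suc n) + z)"
    by metis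
  \<comment> \<open>The series converges to \<open>g\<close> on the whole plane, so it cannot vanish: \<open>g 0 \<noteq> 0\<close>.\<close>
  have nz: "F n \<noteq> 0" for n
  proof
    assume "F n = 0"
    then have "(\<lambda>_. 0) sums g (of_nat (Suc n) + - of_nat (Suc n))"
      using F[of n "- of_nat (Suc n)"] by simp
    then show False
      using g(3) sums_unique2[OF sums_zero] by fastforce
  qed
  have "subdegree (F n) = m n" for n
    using has_fps_expansion_zorder[OF has_fps_expansion_fps_of_real[OF F[of n]]] g(4)[of n] nz[of n]
    by simp
  then show ?thesis
    using g F nz by blast
qed

lemma entire_has_fps_expansion:
  assumes "f holomorphic_on UNIV"
  shows "\<exists>F. (\<lambda>h. f (a + h)) has_fps_expansion F"
proof -
  have "f analytic_on {a}"
    using assms analytic_on_subset[of f UNIV "{a}"] by (simp add: analytic_on_open)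
  then show ?thesis
    using analytic_at_imp_has_fps_expansion by blast
qed

section \<open>The three rings\<close>

lemma krull_dim_entire_ring: "krull_dim_at_least entire_ring (UNIV :: real set)"
  unfolding entire_ring_def
proof (rule krull_dim_function_ring[where a = "\<lambda>n. of_nat (Suc n)"])
  show "cring (function_ring {f :: complex \<Rightarrow> complex. f holomorphic_on UNIV})"
    by (rule cring_function_ring) (auto intro!: holomorphic_intros)
next
  fix m :: "nat \<Rightarrow> nat" assume "\<And>n. m n > 0"
  then obtain g F where g: "g holomorphic_on UNIV"
    and F: "\<And>n. F n \<noteq> 0" "\<And>n. subdegree (F n) = m n"
      "\<And>n z. (\<lambda>k. complex_of_real (fps_nth (F n) k) * z ^ k) sums g (of_nat (Suc n) + z)"
    using prescribed_vanishing_orders[of m] by blast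
  have "(\<lambda>h. g (of_nat (Suc n) + h)) has_fps_expansion fps_of_real (F n)
      \<and> fps_of_real (F n) \<noteq> 0 \<and> subdegree (fps_of_real (F n)) = m n" for n
    using F[of n] has_fps_expansion_fps_of_real[OF F(3)[of n]] by simp
  with g show "\<exists>f\<in>{f. f holomorphic_on UNIV}. \<forall>n. \<exists>F.
      (\<lambda>h. f (of_nat (Suc n) + h)) has_fps_expansion F \<and> F \<noteq> 0 \<and> subdegree F = m n"
    by blast
qed (use entire_has_fps_expansion in blast)

lemma krull_dim_real_entire_ring: "krull_dim_at_least real_entire_ring (UNIV :: real set)"
  unfolding real_entire_ring_def real_power_series_iff_symmetric
proof (rule krull_dim_function_ring[where a = "\<lambda>n. of_nat (Suc n)"])
  show "cring (function_ring {f. f holomorphic_on UNIV \<and> (\<forall>z. f (cnj z) = cnj (f z))})"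
    by (rule cring_function_ring) (auto intro!: holomorphic_intros)
next
  fix m :: "nat \<Rightarrow> nat" assume "\<And>n. m n > 0"
  then obtain g F where g: "g holomorphic_on UNIV" "\<And>z. g (cnj z) = cnj (g z)"
    and F: "\<And>n. F n \<noteq> 0" "\<And>n. subdegree (F n) = m n"
      "\<And>n z. (\<lambda>k. complex_of_real (fps_nth (F n) k) * z ^ k) sums g (of_nat (Suc n) + z)"
    using prescribed_vanishing_orders[of m] by blast
  have "(\<lambda>h. g (of_nat (Suc n) + h)) has_fps_expansion fps_of_real (F n)
      \<and> fps_of_real (F n) \<noteq> 0 \<and> subdegree (fps_of_real (F n)) = m n" for n
    using F[of n] has_fps_expansion_fps_of_real[OF F(3)[of n]] by simp
  with g show "\<exists>f\<in>{f. f holomorphic_on UNIV \<and> (\<forall>z. f (cnj z) = cnj (f z))}. \<forall>n. \<exists>F.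
      (\<lambda>h. f (of_nat (Suc n) + h)) has_fps_expansion F \<and> F \<noteq> 0 \<and> subdegree F = m n"
    by blast
qed (use entire_has_fps_expansion in blast)

lemma krull_dim_real_analytic_ring: "krull_dim_at_least real_analytic_ring (UNIV :: real set)"
  unfolding real_analytic_ring_def
proof (rule krull_dim_function_ring[where a = "\<lambda>n. real (Suc n)"])
  let ?A = "{f :: real \<Rightarrow> real. \<forall>x. \<exists>F. (\<lambda>h. f (x + h)) has_fps_expansion F}"
  show "cring (function_ring ?A)"
  proof (rule cring_function_ring)
    show "(\<lambda>x. f x + g x) \<in> ?A" if "f \<in> ?A" "g \<in> ?A" for f g
      using that has_fps_expansion_add by blast
    show "(\<lambda>x. f x * g x) \<in> ?A" if "f \<in> ?A" "g \<in> ?A" for f g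
      using that has_fps_expansion_mult by blast
    show "(\<lambda>x. - f x) \<in> ?A" if "f \<in> ?A" for f
      using that has_fps_expansion_minus by blast
  qed (use has_fps_expansion_0 has_fps_expansion_1 in blast)+
  fix m :: "nat \<Rightarrow> nat" assume "\<And>n. m n > 0"
  then obtain g F where g: "g holomorphic_on UNIV" "\<And>z. g (cnj z) = cnj (g z)"
    and F: "\<And>n. F n \<noteq> 0" "\<And>n. subdegree (F n) = m n"
      "\<And>n z. (\<lambda>k. complex_of_real (fps_nth (F n) k) * z ^ k) sums g (of_nat (Suc n) + z)"
    using prescribed_vanishing_orders[of m] by blast
  define f where "f x = Re (g (complex_of_real x))" for x
  have "\<exists>G. (\<lambda>h. f (x + h)) has_fps_expansion G" for x
  proof -
    obtain G where "\<And>z. (\<lambda>k. complex_of_real (fps_nth G k) * z ^ k) sums g (of_real x + z)"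
      using real_taylor_expansion[OF g, of x] by blast
    then show ?thesis
      unfolding f_def using has_fps_expansion_real_restriction[of G g x] by blast
  qed
  then have "f \<in> ?A" by blast
  moreover have "(\<lambda>h. f (real (Suc n) + h)) has_fps_expansion F n" for n
    unfolding f_def by (rule has_fps_expansion_real_restriction) (use F(3)[of n] in simp)
  ultimately show "\<exists>f\<in>?A. \<forall>n. \<exists>F.
      (\<lambda>h. f (real (Suc n) + h)) has_fps_expansion F \<and> F \<noteq> 0 \<and> subdegree F = m n"
    using F(1,2) by blast
qed blast

theorem corollary3p14:
  shows "krull_dim_at_least entire_ring (UNIV :: real set)
    \<and> krull_dim_at_least real_entire_ring (UNIV :: real set)
    \<and> krull_dim_at_least real_analytic_ring (UNIV :: real set)"
  using krull_dim_entire_ring krull_dim_real_entire_ring krull_dim_real_analytic_ring by blast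

end
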